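(* Let $M$ be a compact subset of an $\mathbb R$-tree (with a distinguished point $0\in M$) such that $\lambda(M)=0$. Then the Lipschitz-free space $\mathcal F(M)$ is isometric to a subspace of $\ell_1$.
   Context: All Banach spaces are real. For a metric space $(M,d)$ with a distinguished point $0\in M$, $\mathrm{Lip}_0(M)$ is the Banach space of Lipschitz functions $f:M\to\mathbb R$ with $f(0)=0$, with norm $\|f\|_L=\sup\{\frac{f(x)-f(y)}{d(x,y)}:x\neq y\}$. The Lipschitz-free space $\mathcal F(M)$ is the norm-closed linear span of $\{\delta_x:x\in M\}$ in $\mathrm{Lip}_0(M)^*$, where $\delta_x(f)=f(x)$. An $\mathbb R$-tree is a geodesic metric space $(T,d)$ satisfying the 4-point condition: $d(a,b)+d(c,e)\le\max\{d(a,c)+d(b,e),\,d(b,c)+d(a,e)\}$ for all $a,b,c,e\in T$. For $x,y\in T$ let $\phi_{x,y}:[0,d(x,y)]\to T$ be the unique isometric embedding with $\phi_{x,y}(0)=x$ and $\phi_{x,y}(d(x,y))=y$; the segment $[x,y]$ is its range. Measure: a set $A\subset T$ is measurable if $\phi_{x,y}^{-1}(A)$ is Lebesgue measurable for all $x,y\in T$. For a segment $S=[x,y]$ put $\lambda_S(A)=\lambda(\phi_{x,y}^{-1}(A))$ with $\lambda$ Lebesgue measure on $\mathbb R$; for a finite disjoint union $R=\bigcup_{k=1}^r S_k$ of segments put $\lambda_R(A)=\sum_{k=1}^r\lambda_{S_k}(A)$; and $\lambda_T(A)=\sup_R\lambda_R(A)$ over all such $R$. For a subset $M$ of an $\mathbb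 R$-tree, $\mathrm{conv}(M)=\bigcup\{[x,y]:x,y\in M\}$ (the minimal $\mathbb R$-tree containing $M$, unique up to isometry) and $\lambda(M):=\lambda_{\mathrm{conv}(M)}(M)$. *)

theory Defs
  imports "HOL-Analysis.Analysis"
begin

section \<open>Real trees and their length measure\<close>

definition geodesic :: "'a::metric_space set \<Rightarrow> 'a \<Rightarrow> 'a \<Rightarrow> (real \<Rightarrow> 'a) \<Rightarrow> bool" where
  "geodesic T x y \<phi> \<longleftrightarrow>
     \<phi> \<in> {0..dist x y} \<rightarrow> T \<and> \<phi> 0 = x \<and> \<phi> (dist x y) = y \<and>
     (\<forall>s\<in>{0..dist x y}. \<forall>t\<in>{0..dist x y}. dist (\<phi> s) (\<phi> t) = \<bar>s - t\<bar>)"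

definition real_tree :: "'a::metric_space set \<Rightarrow> bool" where
  "real_tree T \<longleftrightarrow>
     (\<forall>x\<in>T. \<forall>y\<in>T. \<exists>\<phi>. geodesic T x y \<phi>) \<and>
     (\<forall>a\<in>T. \<forall>b\<in>T. \<forall>c\<in>T. \<forall>e\<in>T.
        dist a b + dist c e \<le> max (dist a c + dist b e) (dist b c + dist a e))"

text \<open>In a real tree the geodesic is unique on \<open>{0..dist x y}\<close>; its values elsewhere
  are irrelevant and are never used below.\<close>

definition geo :: "'a::metric_space set \<Rightarrow> 'a \<Rightarrow> 'a \<Rightarrow> real \<Rightarrow> 'a" where
  "geo T x y = (SOME \<phi>. geodesic T x y \<phi>)"

definition segment :: "'a::metric_space set \<Rightarrow> 'a \<Rightarrow> 'a \<Rightarrow> 'a set" where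
  "segment T x y = geo T x y ` {0..dist x y}"

definition segment_measure :: "'a::metric_space set \<Rightarrow> 'a \<Rightarrow> 'a \<Rightarrow> 'a set \<Rightarrow> ennreal" where
  "segment_measure T x y A = emeasure lebesgue {t \<in> {0..dist x y}. geo T x y t \<in> A}"

text \<open>A finite disjoint union of segments is given by the finite set \<open>P\<close> of the pairs of
  endpoints. The value is meaningful when every preimage in \<^const>\<open>segment_measure\<close> is Lebesgue
  measurable; for compact \<open>A\<close> the preimages are closed.\<close>

definition tree_measure :: "'a::metric_space set \<Rightarrow> 'a set \<Rightarrow> ennreal" where
  "tree_measure T A =
     (SUP P \<in> {P. finite P \<and> P \<subseteq> T \<times> T \<and> disjoint_family_on (\<lambda>(x, y). segment T x y) P}.
        \<Sum>(x, y)\<in>P. segment_measure T x y A)"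

definition tree_conv :: "'a::metric_space set \<Rightarrow> 'a set \<Rightarrow> 'a set" where
  "tree_conv T M = (\<Union>x\<in>M. \<Union>y\<in>M. segment T x y)"

definition tree_length :: "'a::metric_space set \<Rightarrow> 'a set \<Rightarrow> ennreal" where
  "tree_length T M = tree_measure (tree_conv T M) M"

section \<open>Spaces of real functions\<close>

text \<open>A vector space of functions \<open>'i \<Rightarrow> real\<close> is represented by its carrier set, with
  pointwise operations.\<close>

definition fun_subspace :: "('i \<Rightarrow> real) set \<Rightarrow> bool" where
  "fun_subspace V \<longleftrightarrow>
     (\<lambda>i. 0) \<in> V \<and> (\<forall>u\<in>V. \<forall>v\<in>V. \<forall>a b. (\<lambda>i. a * u i + b * v i) \<in> V)"

definition linear_isometry_between ::
  "('i \<Rightarrow> real) set \<Rightarrow> (('i \<Rightarrow> real) \<Rightarrow> real) \<Rightarrow>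
   ('j \<Rightarrow> real) set \<Rightarrow> (('j \<Rightarrow> real) \<Rightarrow> real) \<Rightarrow>
   (('i \<Rightarrow> real) \<Rightarrow> ('j \<Rightarrow> real)) \<Rightarrow> bool" where
  "linear_isometry_between V normV W normW U \<longleftrightarrow>
     bij_betw U V W \<and>
     (\<forall>u\<in>V. \<forall>v\<in>V. \<forall>a b. U (\<lambda>i. a * u i + b * v i) = (\<lambda>j. a * U u j + b * U v j)) \<and>
     (\<forall>u\<in>V. normW (U u) = normV u)"

definition l1 :: "(nat \<Rightarrow> real) set" where
  "l1 = {x. summable (\<lambda>n. \<bar>x n\<bar>)}"

definition l1_norm :: "(nat \<Rightarrow> real) \<Rightarrow> real" where
  "l1_norm x = (\<Sum>n. \<bar>x n\<bar>)"

section \<open>The Lipschitz-free space\<close>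

text \<open>Functions on \<open>M\<close> are represented by functions vanishing outside \<open>M\<close>, and functionals on
  \<open>Lip0 M z\<close> by functionals vanishing outside \<open>Lip0 M z\<close>, so that equality of representatives
  is equality of the objects represented. The distinguished point is \<open>z\<close>.\<close>

definition Lip0 :: "'a::metric_space set \<Rightarrow> 'a \<Rightarrow> ('a \<Rightarrow> real) set" where
  "Lip0 M z = {f. (\<exists>C. C-lipschitz_on M f) \<and> f z = 0 \<and> (\<forall>x. x \<notin> M \<longrightarrow> f x = 0)}"

text \<open>Inserting \<open>0\<close> only matters if \<open>M\<close> has at most one point: the supremum is nonnegative
  otherwise, by exchanging \<open>x\<close> and \<open>y\<close>.\<close>

definition lip_norm :: "'a::metric_space set \<Rightarrow> ('a \<Rightarrow> real) \<Rightarrow> real" where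
  "lip_norm M f =
     Sup (insert 0 {(f x - f y) / dist x y | x y. x \<in> M \<and> y \<in> M \<and> x \<noteq> y})"

definition Lip0_dual :: "'a::metric_space set \<Rightarrow> 'a \<Rightarrow> (('a \<Rightarrow> real) \<Rightarrow> real) set" where
  "Lip0_dual M z = {\<phi>.
     (\<forall>f\<in>Lip0 M z. \<forall>g\<in>Lip0 M z. \<forall>a b. \<phi> (\<lambda>x. a * f x + b * g x) = a * \<phi> f + b * \<phi> g) \<and>
     (\<exists>K. \<forall>f\<in>Lip0 M z. \<bar>\<phi> f\<bar> \<le> K * lip_norm M f) \<and>
     (\<forall>f. f \<notin> Lip0 M z \<longrightarrow> \<phi> f = 0)}"

definition dual_norm :: "'a::metric_space set \<Rightarrow> 'a \<Rightarrow> (('a \<Rightarrow> real) \<Rightarrow> real) \<Rightarrow> real" where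
  "dual_norm M z \<phi> = (SUP f \<in> {f \<in> Lip0 M z. lip_norm M f \<le> 1}. \<bar>\<phi> f\<bar>)"

definition point_eval :: "'a::metric_space set \<Rightarrow> 'a \<Rightarrow> 'a \<Rightarrow> ('a \<Rightarrow> real) \<Rightarrow> real" where
  "point_eval M z x = (\<lambda>f. if f \<in> Lip0 M z then f x else 0)"

definition point_eval_span :: "'a::metric_space set \<Rightarrow> 'a \<Rightarrow> (('a \<Rightarrow> real) \<Rightarrow> real) set" where
  "point_eval_span M z =
     {\<lambda>f. \<Sum>x\<in>A. c x * point_eval M z x f | A c. finite A \<and> A \<subseteq> M}"

definition free_space :: "'a::metric_space set \<Rightarrow> 'a \<Rightarrow> (('a \<Rightarrow> real) \<Rightarrow> real) set" where
  "free_space M z =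
     {\<phi> \<in> Lip0_dual M z. \<forall>\<epsilon>>0. \<exists>\<psi>\<in>point_eval_span M z. dual_norm M z (\<lambda>f. \<phi> f - \<psi> f) < \<epsilon>}"

end

theory Submission
  imports Defs
begin

text \<open>Root the tree at \<open>z\<close>. A height \<open>t\<close> at which the segment from \<open>z\<close> to \<open>x \<in> M\<close> avoids \<open>M\<close> cuts
  off a relatively clopen subset of \<open>M\<close>, its cluster. There are countably many clusters \<open>A\<close>; the
  points of the tree that cut off \<open>A\<close> form a half-open segment of some length \<open>w(A) > 0\<close>, and as
  \<open>M\<close> is null, the segments belonging to the clusters around \<open>x\<close> cover \<open>[z, x]\<close> up to a null set.
  Put \<open>e\<^sub>A = w(A) 1\<^sub>A\<close>. Since the segments are disjoint, \<open>\<Sum>\<^sub>A |e\<^sub>A(x) - e\<^sub>A(y)| \<le> d(x, y)\<close>, so all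
  signed sums of the \<open>e\<^sub>A\<close> are 1-Lipschitz. Conversely, extend a 1-Lipschitz function on \<open>M\<close> to the
  tree and add up its increments over the segments: this writes it as \<open>\<Sum>\<^sub>A \<sigma>\<^sub>A e\<^sub>A\<close> with
  \<open>|\<sigma>\<^sub>A| \<le> 1\<close>. Hence \<open>\<phi> \<mapsto> (\<phi>(e\<^sub>A))\<^sub>A\<close> is isometric from the free space into \<open>\<ell>\<^sub>1\<close>.\<close>

section \<open>Norms on Lipschitz functions and their dual\<close>

lemma lip_norm_bdd_above:
  assumes "f \<in> Lip0 M z"
  shows "bdd_above (insert 0 {(f x - f y) / dist x y | x y. x \<in> M \<and> y \<in> M \<and> x \<noteq> y})"
proof -
  obtain C where C: "C-lipschitz_on M f"
    using assms by (auto simp: Lip0_def)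
  have "(f x - f y) / dist x y \<le> C" if "x \<in> M" "y \<in> M" "x \<noteq> y" for x y
    using lipschitz_onD[OF C that(1,2)] that(3)
    by (simp add: dist_real_def divide_le_eq)
  then show ?thesis
    using lipschitz_on_nonneg[OF C] by (intro bdd_aboveI[of _ C]) auto
qed

lemma lip_norm_nonneg: "f \<in> Lip0 M z \<Longrightarrow> 0 \<le> lip_norm M f"
  unfolding lip_norm_def by (rule cSup_upper[OF _ lip_norm_bdd_above]) auto

lemma lipschitz_on_lip_norm:
  assumes "f \<in> Lip0 M z"
  shows "(lip_norm M f)-lipschitz_on M f"
proof (rule lipschitz_onI)
  \<comment> \<open>\<open>lip_norm\<close> bounds signed quotients only; using this for both orders
    of \<open>x\<close> and \<open>y\<close> gives the absolute value.\<close>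
  have le: "f x - f y \<le> lip_norm M f * dist x y" if "x \<in> M" "y \<in> M" for x y
  proof (cases "x = y")
    case False
    then have "(f x - f y) / dist x y \<le> lip_norm M f"
      unfolding lip_norm_def
      by (intro cSup_upper[OF _ lip_norm_bdd_above[OF assms]]) (use that in auto)
    then show ?thesis
      using False by (simp add: divide_le_eq)
  qed simp
  then show "dist (f x) (f y) \<le> lip_norm M f * dist x y" if "x \<in> M" "y \<in> M" for x y
    using le[OF that] le[OF that(2,1)] by (auto simp: dist_real_def dist_commute abs_le_iff)
qed (rule lip_norm_nonneg[OF assms])

lemma lip_norm_le:
  assumes "C-lipschitz_on M f"
  shows "lip_norm M f \<le> C"
proof -
  have "(f x - f y) / dist x y \<le> C" if "x \<in> M" "y \<in> M" "x \<noteq> y" for x y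
    using lipschitz_onD[OF assms that(1,2)] that(3)
    by (simp add: dist_real_def divide_le_eq)
  then show ?thesis
    unfolding lip_norm_def using lipschitz_on_nonneg[OF assms] by (intro cSup_least) auto
qed

lemma Lip0_combination:
  assumes "f \<in> Lip0 M z" "g \<in> Lip0 M z"
  shows "(\<lambda>x. a * f x + b * g x) \<in> Lip0 M z"
proof -
  have "(\<bar>a\<bar> * lip_norm M f + \<bar>b\<bar> * lip_norm M g)-lipschitz_on M (\<lambda>x. a * f x + b * g x)"
    using lipschitz_on_add[OF lipschitz_on_cmult_real[OF lipschitz_on_lip_norm[OF assms(1)]]
        lipschitz_on_cmult_real[OF lipschitz_on_lip_norm[OF assms(2)]], of a b]
    by simp
  then show ?thesis
    using assms by (auto simp: Lip0_def)
qed

lemma Lip0_zero: "(\<lambda>x. 0) \<in> Lip0 M z"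
  by (auto simp: Lip0_def intro!: exI[of _ 0] lipschitz_onI)

lemma Lip0_sum:
  assumes "\<And>i. i \<in> I \<Longrightarrow> f i \<in> Lip0 M z"
  shows "(\<lambda>x. \<Sum>i\<in>I. a i * f i x) \<in> Lip0 M z"
  using assms
proof (induction I rule: infinite_finite_induct)
  case (insert i I)
  then show ?case
    using Lip0_combination[of "f i" M z "\<lambda>x. \<Sum>i\<in>I. a i * f i x" "a i" 1] by simp
qed (simp_all add: Lip0_zero)

lemma Lip0_dual_linear:
  "\<phi> \<in> Lip0_dual M z \<Longrightarrow> f \<in> Lip0 M z \<Longrightarrow> g \<in> Lip0 M z \<Longrightarrow>
    \<phi> (\<lambda>x. a * f x + b * g x) = a * \<phi> f + b * \<phi> g"
  unfolding Lip0_dual_def by blast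

lemma Lip0_dual_bounded:
  assumes "\<phi> \<in> Lip0_dual M z"
  obtains K where "\<And>f. f \<in> Lip0 M z \<Longrightarrow> \<bar>\<phi> f\<bar> \<le> K * lip_norm M f"
  using assms unfolding Lip0_dual_def by blast

lemma Lip0_dual_outside: "\<phi> \<in> Lip0_dual M z \<Longrightarrow> f \<notin> Lip0 M z \<Longrightarrow> \<phi> f = 0"
  unfolding Lip0_dual_def by blast

lemma Lip0_dual_sum:
  assumes "\<phi> \<in> Lip0_dual M z" "\<And>i. i \<in> I \<Longrightarrow> f i \<in> Lip0 M z"
  shows "\<phi> (\<lambda>x. \<Sum>i\<in>I. a i * f i x) = (\<Sum>i\<in>I. a i * \<phi> (f i))"
proof -
  note lin = Lip0_dual_linear[OF assms(1)]
  have zero: "\<phi> (\<lambda>x. 0) = 0"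
    using lin[OF Lip0_zero Lip0_zero, of 0 0] by simp
  show ?thesis
    using assms(2)
  proof (induction I rule: infinite_finite_induct)
    case (insert i I)
    then show ?case
      using lin[of "f i" "\<lambda>x. \<Sum>i\<in>I. a i * f i x" "a i" 1] by (simp add: Lip0_sum)
  qed (simp_all add: zero)
qed

lemma Lip0_dual_combination:
  assumes "\<phi> \<in> Lip0_dual M z" "\<psi> \<in> Lip0_dual M z"
  shows "(\<lambda>f. a * \<phi> f + b * \<psi> f) \<in> Lip0_dual M z"
proof -
  obtain K where K: "\<And>f. f \<in> Lip0 M z \<Longrightarrow> \<bar>\<phi> f\<bar> \<le> K * lip_norm M f"
    using Lip0_dual_bounded[OF assms(1)] by blast
  obtain L where L: "\<And>f. f \<in> Lip0 M z \<Longrightarrow> \<bar>\<psi> f\<bar> \<le> L * lip_norm M f"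
    using Lip0_dual_bounded[OF assms(2)] by blast
  have "\<bar>a * \<phi> f + b * \<psi> f\<bar> \<le> (\<bar>a\<bar> * K + \<bar>b\<bar> * L) * lip_norm M f" if "f \<in> Lip0 M z" for f
  proof -
    have "\<bar>a * \<phi> f + b * \<psi> f\<bar> \<le> \<bar>a\<bar> * \<bar>\<phi> f\<bar> + \<bar>b\<bar> * \<bar>\<psi> f\<bar>"
      by (metis abs_mult abs_triangle_ineq)
    also have "\<dots> \<le> \<bar>a\<bar> * (K * lip_norm M f) + \<bar>b\<bar> * (L * lip_norm M f)"
      by (intro add_mono mult_left_mono K L that) auto
    finally show ?thesis
      by (simp add: algebra_simps)
  qed
  then have "\<exists>K. \<forall>f\<in>Lip0 M z. \<bar>a * \<phi> f + b * \<psi> f\<bar> \<le> K * lip_norm M f"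
    by blast
  moreover have "a * \<phi> (\<lambda>x. c * f x + d * g x) + b * \<psi> (\<lambda>x. c * f x + d * g x)
      = c * (a * \<phi> f + b * \<psi> f) + d * (a * \<phi> g + b * \<psi> g)"
    if "f \<in> Lip0 M z" "g \<in> Lip0 M z" for f g c d
    unfolding Lip0_dual_linear[OF assms(1) that] Lip0_dual_linear[OF assms(2) that]
    by (simp add: algebra_simps)
  moreover have "a * \<phi> f + b * \<psi> f = 0" if "f \<notin> Lip0 M z" for f
    using Lip0_dual_outside[OF assms(1) that] Lip0_dual_outside[OF assms(2) that] by simp
  ultimately show ?thesis
    unfolding Lip0_dual_def by blast
qed

lemma Lip0_dual_diff:
  assumes "\<phi> \<in> Lip0_dual M z" "\<psi> \<in> Lip0_dual M z"
  shows "(\<lambda>f. \<phi> f - \<psi> f) \<in> Lip0_dual M z"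
  using Lip0_dual_combination[OF assms, of 1 "-1"] by simp

lemma Lip0_dual_zero: "(\<lambda>f. 0) \<in> Lip0_dual M z"
  by (auto simp: Lip0_dual_def intro: exI[of _ 0])

lemma dual_norm_bdd_above:
  assumes "\<phi> \<in> Lip0_dual M z"
  shows "bdd_above ((\<lambda>f. \<bar>\<phi> f\<bar>) ` {f \<in> Lip0 M z. lip_norm M f \<le> 1})"
proof -
  obtain K where K: "\<And>f. f \<in> Lip0 M z \<Longrightarrow> \<bar>\<phi> f\<bar> \<le> K * lip_norm M f"
    using Lip0_dual_bounded[OF assms] by blast
  have "\<bar>\<phi> f\<bar> \<le> \<bar>K\<bar>" if "f \<in> Lip0 M z" "lip_norm M f \<le> 1" for f
  proof -
    have "K * lip_norm M f \<le> \<bar>K\<bar> * 1"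
      using that lip_norm_nonneg[OF that(1)] by (intro mult_mono) auto
    then show ?thesis
      using K[OF that(1)] by simp
  qed
  then show ?thesis
    by (intro bdd_aboveI2) auto
qed

lemma abs_le_dual_norm:
  assumes "\<phi> \<in> Lip0_dual M z" "f \<in> Lip0 M z" "lip_norm M f \<le> 1"
  shows "\<bar>\<phi> f\<bar> \<le> dual_norm M z \<phi>"
  unfolding dual_norm_def
  by (rule cSUP_upper[OF _ dual_norm_bdd_above[OF assms(1)]]) (use assms in auto)

lemma dual_norm_least:
  assumes "\<And>f. f \<in> Lip0 M z \<Longrightarrow> lip_norm M f \<le> 1 \<Longrightarrow> \<bar>\<phi> f\<bar> \<le> C"
  shows "dual_norm M z \<phi> \<le> C"
proof -
  have "lip_norm M (\<lambda>x. 0) \<le> 0"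
    by (rule lip_norm_le) (simp add: lipschitz_on_def)
  then have "(\<lambda>x. 0) \<in> {f \<in> Lip0 M z. lip_norm M f \<le> 1}"
    by (simp add: Lip0_zero)
  then show ?thesis
    unfolding dual_norm_def using assms by (intro cSUP_least) auto
qed

lemma dual_norm_combination_le:
  assumes "\<phi> \<in> Lip0_dual M z" "\<psi> \<in> Lip0_dual M z"
  shows "dual_norm M z (\<lambda>f. a * \<phi> f + b * \<psi> f) \<le> \<bar>a\<bar> * dual_norm M z \<phi> + \<bar>b\<bar> * dual_norm M z \<psi>"
proof (rule dual_norm_least)
  fix f assume f: "f \<in> Lip0 M z" "lip_norm M f \<le> 1"
  have "\<bar>a * \<phi> f + b * \<psi> f\<bar> \<le> \<bar>a\<bar> * \<bar>\<phi> f\<bar> + \<bar>b\<bar> * \<bar>\<psi> f\<bar>"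
    by (metis abs_mult abs_triangle_ineq)
  also have "\<dots> \<le> \<bar>a\<bar> * dual_norm M z \<phi> + \<bar>b\<bar> * dual_norm M z \<psi>"
    by (intro add_mono mult_left_mono abs_le_dual_norm assms f) auto
  finally show "\<bar>a * \<phi> f + b * \<psi> f\<bar> \<le> \<bar>a\<bar> * dual_norm M z \<phi> + \<bar>b\<bar> * dual_norm M z \<psi>" .
qed

lemma dual_norm_eq_0:
  assumes "\<phi> \<in> Lip0_dual M z" "dual_norm M z \<phi> = 0"
  shows "\<phi> = (\<lambda>f. 0)"
proof
  fix f
  show "\<phi> f = 0"
  proof (cases "f \<in> Lip0 M z \<and> lip_norm M f \<noteq> 0")
    case False
    then consider "f \<notin> Lip0 M z" | "f \<in> Lip0 M z" "lip_norm M f = 0"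
      by blast
    then show ?thesis
    proof cases
      \<comment> \<open>A function of norm 0 cannot be scaled to norm 1; here the bound on
        \<open>\<phi>\<close> itself forces the value 0.\<close>
      case 2
      obtain K where "\<And>f. f \<in> Lip0 M z \<Longrightarrow> \<bar>\<phi> f\<bar> \<le> K * lip_norm M f"
        using Lip0_dual_bounded[OF assms(1)] by blast
      from this[OF 2(1)] show ?thesis
        by (simp add: 2(2))
    qed (rule Lip0_dual_outside[OF assms(1)])
  next
    case True
    then have f: "f \<in> Lip0 M z" and pos: "0 < lip_norm M f"
      using lip_norm_nonneg[of f M z] by auto
    \<comment> \<open>The summand with coefficient 0 puts \<open>f\<close>, scaled to norm 1, into
      the two-term form of the linearity facts.\<close>
    define g where "g = (\<lambda>x. (1 / lip_norm M f) * f x + 0 * f x)"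
    have g: "g \<in> Lip0 M z"
      unfolding g_def by (rule Lip0_combination[OF f f])
    have "(\<bar>1 / lip_norm M f\<bar> * lip_norm M f)-lipschitz_on M (\<lambda>x. (1 / lip_norm M f) * f x)"
      by (rule lipschitz_on_cmult_real[OF lipschitz_on_lip_norm[OF f]])
    then have "lip_norm M g \<le> 1"
      using pos by (intro lip_norm_le) (simp add: g_def)
    then have "\<phi> g = 0"
      using abs_le_dual_norm[OF assms(1) g] assms(2) by simp
    moreover have "\<phi> g = (1 / lip_norm M f) * \<phi> f + 0 * \<phi> f"
      unfolding g_def by (rule Lip0_dual_linear[OF assms(1) f f])
    ultimately show ?thesis
      using pos by simp
  qed
qed

section \<open>The free space\<close>

lemma point_eval_dual:
  assumes "x \<in> M" "z \<in> M"
  shows "point_eval M z x \<in> Lip0_dual M z"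
proof -
  have "\<bar>f x\<bar> \<le> dist x z * lip_norm M f" if "f \<in> Lip0 M z" for f
    using lipschitz_onD[OF lipschitz_on_lip_norm[OF that] assms] that
    by (simp add: Lip0_def dist_real_def mult.commute)
  then have "\<exists>K. \<forall>f\<in>Lip0 M z. \<bar>point_eval M z x f\<bar> \<le> K * lip_norm M f"
    by (auto simp: point_eval_def)
  then show ?thesis
    by (auto simp: Lip0_dual_def point_eval_def Lip0_combination)
qed

lemma point_eval_span_dual:
  assumes "\<psi> \<in> point_eval_span M z" "z \<in> M"
  shows "\<psi> \<in> Lip0_dual M z"
proof -
  obtain A c where A: "finite A" "A \<subseteq> M" and \<psi>: "\<psi> = (\<lambda>f. \<Sum>x\<in>A. c x * point_eval M z x f)"
    using assms(1) by (auto simp: point_eval_span_def)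
  show ?thesis
    unfolding \<psi> using A
  proof (induction A rule: finite_induct)
    case empty
    then show ?case by (simp add: Lip0_dual_zero)
  next
    case (insert x A)
    then show ?case
      using Lip0_dual_combination[OF point_eval_dual[of x M z]
          insert.IH, of "c x" 1] assms(2) by simp
  qed
qed

lemma point_eval_span_combination:
  assumes "\<phi> \<in> point_eval_span M z" "\<psi> \<in> point_eval_span M z"
  shows "(\<lambda>f. a * \<phi> f + b * \<psi> f) \<in> point_eval_span M z"
proof -
  obtain A c where A: "finite A" "A \<subseteq> M" and \<phi>: "\<phi> = (\<lambda>f. \<Sum>x\<in>A. c x * point_eval M z x f)"
    using assms(1) by (auto simp: point_eval_span_def)
  obtain B d where B: "finite B" "B \<subseteq> M" and \<psi>: "\<psi> = (\<lambda>f. \<Sum>x\<in>B. d x * point_eval M z x f)"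
    using assms(2) by (auto simp: point_eval_span_def)
  \<comment> \<open>Both coefficient families are extended by zero to \<open>A \<union> B\<close>,
    where they can be added.\<close>
  define h where "h x = a * (if x \<in> A then c x else 0) + b * (if x \<in> B then d x else 0)" for x
  have 1: "\<phi> f = (\<Sum>x\<in>A \<union> B. (if x \<in> A then c x else 0) * point_eval M z x f)" for f
    unfolding \<phi> using A B by (intro sum.mono_neutral_cong_left) auto
  have 2: "\<psi> f = (\<Sum>x\<in>A \<union> B. (if x \<in> B then d x else 0) * point_eval M z x f)" for f
    unfolding \<psi> using A B by (intro sum.mono_neutral_cong_left) auto
  have "(\<lambda>f. a * \<phi> f + b * \<psi> f) = (\<lambda>f. \<Sum>x\<in>A \<union> B. h x * point_eval M z x f)"
    unfolding 1 2 h_def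
    by (simp add: sum_distrib_left sum.distrib[symmetric] algebra_simps)
  moreover have "finite (A \<union> B)" "A \<union> B \<subseteq> M"
    using A B by auto
  ultimately show ?thesis
    unfolding point_eval_span_def by blast
qed

lemma free_space_combination:
  assumes z: "z \<in> M" and \<phi>: "\<phi> \<in> free_space M z" and \<psi>: "\<psi> \<in> free_space M z"
  shows "(\<lambda>f. a * \<phi> f + b * \<psi> f) \<in> free_space M z"
proof -
  have dual: "\<phi> \<in> Lip0_dual M z" "\<psi> \<in> Lip0_dual M z"
    using \<phi> \<psi> by (auto simp: free_space_def)
  have "\<exists>\<theta>\<in>point_eval_span M z. dual_norm M z (\<lambda>f. a * \<phi> f + b * \<psi> f - \<theta> f) < \<epsilon>"
    if "\<epsilon> > 0" for \<epsilon>
  proof -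
    \<comment> \<open>The 1 in the denominator covers \<open>a = b = 0\<close> and makes the final
      estimate strict.\<close>
    define \<delta> where "\<delta> = \<epsilon> / (\<bar>a\<bar> + \<bar>b\<bar> + 1)"
    have pos: "\<bar>a\<bar> + \<bar>b\<bar> + 1 > 0"
      by linarith
    have "\<delta> > 0"
      using that pos unfolding \<delta>_def by (rule divide_pos_pos)
    then obtain \<phi>' \<psi>' where
      span: "\<phi>' \<in> point_eval_span M z" "\<psi>' \<in> point_eval_span M z"
      and \<phi>': "dual_norm M z (\<lambda>f. \<phi> f - \<phi>' f) < \<delta>"
      and \<psi>': "dual_norm M z (\<lambda>f. \<psi> f - \<psi>' f) < \<delta>"
      using \<phi> \<psi> unfolding free_space_def by blast
    have "dual_norm M z (\<lambda>f. a * \<phi> f + b * \<psi> f - (a * \<phi>' f + b * \<psi>' f))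
        = dual_norm M z (\<lambda>f. a * (\<phi> f - \<phi>' f) + b * (\<psi> f - \<psi>' f))"
      by (simp add: algebra_simps)
    also have "\<dots> \<le> \<bar>a\<bar> * dual_norm M z (\<lambda>f. \<phi> f - \<phi>' f) + \<bar>b\<bar> * dual_norm M z (\<lambda>f. \<psi> f - \<psi>' f)"
      by (intro dual_norm_combination_le Lip0_dual_diff dual point_eval_span_dual span z)
    also have "\<dots> \<le> \<bar>a\<bar> * \<delta> + \<bar>b\<bar> * \<delta>"
      using \<phi>' \<psi>' by (intro add_mono mult_left_mono) auto
    also have "\<dots> < (\<bar>a\<bar> + \<bar>b\<bar> + 1) * \<delta>"
      using \<open>\<delta> > 0\<close> by (simp add: algebra_simps)
    also have "\<dots> = \<epsilon>"
      using pos by (simp add: \<delta>_def)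
    finally show ?thesis
      using point_eval_span_combination[OF span, of a b] by (rule bexI)
  qed
  then show ?thesis
    using Lip0_dual_combination[OF dual, of a b] by (auto simp: free_space_def)
qed

lemma free_space_zero: "(\<lambda>f. 0) \<in> free_space M z"
proof -
  have "(\<lambda>f. 0) \<in> point_eval_span M z"
    unfolding point_eval_span_def by (auto intro!: exI[of _ "{}"])
  moreover have "dual_norm M z (\<lambda>f. 0 - 0) < \<epsilon>" if "\<epsilon> > 0" for \<epsilon>
    using dual_norm_least[of M z "\<lambda>f. 0" 0] that by simp
  ultimately have "\<forall>\<epsilon>>0. \<exists>\<psi>\<in>point_eval_span M z. dual_norm M z (\<lambda>f. 0 - \<psi> f) < \<epsilon>"
    by (intro allI impI bexI[of _ "\<lambda>f. 0"])
  then show ?thesis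
    by (simp add: free_space_def Lip0_dual_zero)
qed

text \<open>The coordinates of the embedding are the values of a functional on the functions \<open>e n\<close>. The
  first inequality puts every signed sum of the \<open>e n\<close> into the unit ball of \<^term>\<open>Lip0 M z\<close>; the
  expansion says that these sums, with coefficients in \<open>[-1, 1]\<close>, exhaust the ball.\<close>

lemma free_space_isometric_l1:
  fixes e :: "nat \<Rightarrow> 'a::metric_space \<Rightarrow> real"
  assumes z: "z \<in> M"
    and e_base: "\<And>n. e n z = 0"
    and e_outside: "\<And>n x. x \<notin> M \<Longrightarrow> e n x = 0"
    and e_dist: "\<And>N x y. x \<in> M \<Longrightarrow> y \<in> M \<Longrightarrow> (\<Sum>n<N. \<bar>e n x - e n y\<bar>) \<le> dist x y"
    and e_expand: "\<And>f. 1-lipschitz_on M f \<Longrightarrow> f z = 0 \<Longrightarrow>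
      \<exists>\<sigma>. (\<forall>n. \<bar>\<sigma> n\<bar> \<le> 1) \<and> (\<forall>x\<in>M. (\<lambda>n. \<sigma> n * e n x) sums f x)"
  shows "\<exists>S U. S \<subseteq> l1 \<and> fun_subspace S \<and>
           linear_isometry_between (free_space M z) (dual_norm M z) S l1_norm U"
proof -
  define U where "U \<phi> n = \<phi> (e n)" for \<phi> :: "('a \<Rightarrow> real) \<Rightarrow> real" and n
  have comb: "1-lipschitz_on M (\<lambda>x. \<Sum>n<N. \<sigma> n * e n x)"
    if "\<And>n. \<bar>\<sigma> n\<bar> \<le> 1" for \<sigma> N
  proof (rule lipschitz_onI)
    fix x y assume xy: "x \<in> M" "y \<in> M"
    have "\<bar>\<Sum>n<N. \<sigma> n * (e n x - e n y)\<bar> \<le> (\<Sum>n<N. \<bar>\<sigma> n\<bar> * \<bar>e n x - e n y\<bar>)"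
      using sum_abs[of "\<lambda>n. \<sigma> n * (e n x - e n y)" "{..<N}"] by (simp add: abs_mult)
    also have "\<dots> \<le> (\<Sum>n<N. \<bar>e n x - e n y\<bar>)"
      using that by (intro sum_mono mult_left_le_one_le) auto
    also have "\<dots> \<le> dist x y"
      by (rule e_dist[OF xy])
    finally show "dist (\<Sum>n<N. \<sigma> n * e n x) (\<Sum>n<N. \<sigma> n * e n y) \<le> 1 * dist x y"
      by (simp add: dist_real_def sum_subtractf[symmetric] right_diff_distrib)
  qed simp
  have e_Lip0: "e n \<in> Lip0 M z" for n
  proof -
    \<comment> \<open>\<open>e n\<close> is the signed sum with coefficient 1 at \<open>n\<close>
      and 0 elsewhere; the bound \<open>Suc n\<close> is the first that includes the index
      \<open>n\<close>.\<close>
    have "1-lipschitz_on M (e n)"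
      using comb[of "\<lambda>k. if k = n then 1 else 0" "Suc n"]
      by (simp add: if_distrib[of "\<lambda>a. a * _"] cong: if_cong)
    then show ?thesis
      using e_base e_outside by (auto simp: Lip0_def)
  qed
  \<comment> \<open>The signs \<open>sgn (U \<phi> n)\<close> turn the sum of absolute values into
    one value of \<open>\<phi>\<close> on the unit ball.\<close>
  have partial: "(\<Sum>n<N. \<bar>U \<phi> n\<bar>) \<le> dual_norm M z \<phi>" if \<phi>: "\<phi> \<in> Lip0_dual M z" for \<phi> N
  proof -
    have "(\<Sum>n<N. \<bar>U \<phi> n\<bar>) = (\<Sum>n<N. sgn (U \<phi> n) * \<phi> (e n))"
      by (simp add: U_def abs_sgn mult.commute)
    also have "\<dots> = \<phi> (\<lambda>x. \<Sum>n<N. sgn (U \<phi> n) * e n x)"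
      by (rule Lip0_dual_sum[OF \<phi> e_Lip0, symmetric])
    also have "\<dots> \<le> \<bar>\<phi> (\<lambda>x. \<Sum>n<N. sgn (U \<phi> n) * e n x)\<bar>"
      by simp
    also have "\<dots> \<le> dual_norm M z \<phi>"
      by (intro abs_le_dual_norm[OF \<phi>] Lip0_sum e_Lip0 lip_norm_le comb) (simp add: sgn_real_def)
    finally show ?thesis .
  qed
  have summ: "summable (\<lambda>n. \<bar>U \<phi> n\<bar>)" if "\<phi> \<in> Lip0_dual M z" for \<phi>
  proof (rule bounded_imp_summable)
    show "(\<Sum>k\<le>n. \<bar>U \<phi> k\<bar>) \<le> dual_norm M z \<phi>" for n
      using partial[OF that, of "Suc n"] by (simp only: lessThan_Suc_atMost)
  qed simp
  have upper: "l1_norm (U \<phi>) \<le> dual_norm M z \<phi>" if "\<phi> \<in> Lip0_dual M z" for \<phi>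
    unfolding l1_norm_def using partial[OF that] summ[OF that] by (intro suminf_le_const) auto
  \<comment> \<open>The expansion of \<open>f\<close> is given pointwise on \<open>M\<close>, so it
    can be interchanged with a finite combination of evaluations.\<close>
  have span: "dual_norm M z \<psi> \<le> l1_norm (U \<psi>)" if \<psi>_span: "\<psi> \<in> point_eval_span M z" for \<psi>
  proof (rule dual_norm_least)
    fix f assume f: "f \<in> Lip0 M z" "lip_norm M f \<le> 1"
    have "1-lipschitz_on M f"
      using lipschitz_on_le[OF lipschitz_on_lip_norm[OF f(1)] f(2)] .
    then obtain \<sigma> where \<sigma>: "\<And>n. \<bar>\<sigma> n\<bar> \<le> 1" and sums: "\<And>x. x \<in> M \<Longrightarrow> (\<lambda>n. \<sigma> n * e n x) sums f x"
      using e_expand[of f] f(1) by (auto simp: Lip0_def)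
    obtain A c where A: "finite A" "A \<subseteq> M" and \<psi>: "\<psi> = (\<lambda>f. \<Sum>x\<in>A. c x * point_eval M z x f)"
      using \<psi>_span by (auto simp: point_eval_span_def)
    have "(\<lambda>n. \<Sum>x\<in>A. c x * (\<sigma> n * e n x)) sums (\<Sum>x\<in>A. c x * f x)"
      using A by (intro sums_sum sums_mult sums) auto
    moreover have "(\<Sum>x\<in>A. c x * (\<sigma> n * e n x)) = \<sigma> n * U \<psi> n" for n
      by (simp add: U_def \<psi> point_eval_def e_Lip0 sum_distrib_left algebra_simps)
    moreover have "(\<Sum>x\<in>A. c x * f x) = \<psi> f"
      by (simp add: \<psi> point_eval_def f)
    ultimately have *: "(\<lambda>n. \<sigma> n * U \<psi> n) sums \<psi> f"
      by simp
    have le: "\<bar>\<sigma> n * U \<psi> n\<bar> \<le> \<bar>U \<psi> n\<bar>" for n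
      using \<sigma>[of n] by (simp add: abs_mult mult_left_le_one_le)
    have s: "summable (\<lambda>n. \<bar>U \<psi> n\<bar>)"
      by (rule summ[OF point_eval_span_dual[OF \<psi>_span z]])
    have s': "summable (\<lambda>n. \<bar>\<sigma> n * U \<psi> n\<bar>)"
      by (rule summable_comparison_test[OF _ s]) (use le in auto)
    have "\<bar>\<psi> f\<bar> \<le> (\<Sum>n. \<bar>\<sigma> n * U \<psi> n\<bar>)"
      using summable_rabs[OF s'] sums_unique[OF *] by simp
    also have "\<dots> \<le> l1_norm (U \<psi>)"
      unfolding l1_norm_def by (rule suminf_le[OF le s' s])
    finally show "\<bar>\<psi> f\<bar> \<le> l1_norm (U \<psi>)" .
  qed
  \<comment> \<open>Passage to the norm closure: replacing \<open>\<phi>\<close> by a nearby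
    \<open>\<psi>\<close> of the span costs less than \<open>\<epsilon> / 2\<close> in either norm,
    since \<open>upper\<close> controls the \<open>l1\<close> cost.\<close>
  have lower: "dual_norm M z \<phi> \<le> l1_norm (U \<phi>)" if \<phi>: "\<phi> \<in> free_space M z" for \<phi>
  proof (rule field_le_epsilon)
    fix \<epsilon> :: real assume "\<epsilon> > 0"
    then obtain \<psi> where \<psi>: "\<psi> \<in> point_eval_span M z"
      and close: "dual_norm M z (\<lambda>f. \<phi> f - \<psi> f) < \<epsilon> / 2"
      using \<phi> half_gt_zero unfolding free_space_def by blast
    have dual: "\<phi> \<in> Lip0_dual M z" "\<psi> \<in> Lip0_dual M z"
      using \<phi> point_eval_span_dual[OF \<psi> z] by (auto simp: free_space_def)
    note diff = Lip0_dual_diff[OF dual]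
    have "dual_norm M z \<phi> \<le> dual_norm M z (\<lambda>f. \<phi> f - \<psi> f) + dual_norm M z \<psi>"
      using dual_norm_combination_le[OF diff dual(2), of 1 1] by simp
    moreover have "l1_norm (U \<psi>) \<le> l1_norm (U \<phi>) + l1_norm (U (\<lambda>f. \<phi> f - \<psi> f))"
      unfolding l1_norm_def suminf_add[OF summ[OF dual(1)] summ[OF diff]]
      by (intro suminf_le summable_add summ dual diff) (simp add: U_def)
    ultimately show "dual_norm M z \<phi> \<le> l1_norm (U \<phi>) + \<epsilon>"
      using span[OF \<psi>] upper[OF diff] close by linarith
  qed
  have norm: "l1_norm (U \<phi>) = dual_norm M z \<phi>" if "\<phi> \<in> free_space M z" for \<phi>
    using upper[of \<phi>] lower[OF that] that by (auto simp: free_space_def)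
  have linear: "U (\<lambda>f. a * \<phi> f + b * \<psi> f) = (\<lambda>n. a * U \<phi> n + b * U \<psi> n)" for a b \<phi> \<psi>
    by (simp add: U_def fun_eq_iff)
  have "inj_on U (free_space M z)"
  proof (rule inj_onI)
    fix \<phi> \<psi> assume mem: "\<phi> \<in> free_space M z" "\<psi> \<in> free_space M z" and eq: "U \<phi> = U \<psi>"
    define \<theta> where "\<theta> = (\<lambda>f. 1 * \<phi> f + (-1) * \<psi> f)"
    have \<theta>: "\<theta> \<in> free_space M z"
      unfolding \<theta>_def by (rule free_space_combination[OF z mem])
    have "U \<theta> = (\<lambda>n. 0)"
      unfolding \<theta>_def linear using eq by simp
    then have "dual_norm M z \<theta> = 0"
      using norm[OF \<theta>] by (simp add: l1_norm_def)
    then have "\<theta> = (\<lambda>f. 0)"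
      using \<theta> by (intro dual_norm_eq_0) (auto simp: free_space_def)
    then show "\<phi> = \<psi>"
      by (auto simp: \<theta>_def fun_eq_iff)
  qed
  then have "linear_isometry_between (free_space M z) (dual_norm M z) (U ` free_space M z) l1_norm U"
    unfolding linear_isometry_between_def
    by (intro conjI ballI allI inj_on_imp_bij_betw linear norm)
  moreover have "U ` free_space M z \<subseteq> l1"
    using summ by (auto simp: l1_def free_space_def)
  moreover have "fun_subspace (U ` free_space M z)"
    unfolding fun_subspace_def
  proof (intro conjI ballI allI)
    have "U (\<lambda>f. 0) = (\<lambda>i. 0)"
      by (simp add: U_def fun_eq_iff)
    then show "(\<lambda>i. 0) \<in> U ` free_space M z"
      using free_space_zero by (metis imageI)
    fix u v a b assume "u \<in> U ` free_space M z" "v \<in> U ` free_space M z"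
    then obtain \<phi> \<psi> where mem: "\<phi> \<in> free_space M z" "\<psi> \<in> free_space M z" and uv: "u = U \<phi>" "v = U \<psi>"
      by blast
    show "(\<lambda>i. a * u i + b * v i) \<in> U ` free_space M z"
      unfolding uv linear[symmetric] by (intro imageI free_space_combination z mem)
  qed
  ultimately show ?thesis
    by blast
qed

section \<open>Increments over disjoint intervals\<close>

text \<open>Induction on the number of intervals: the one with the largest left endpoint
  \<open>a i\<close> is split off, the others lie in \<open>{c..a i}\<close>, and monotonicity
  absorbs the gaps.\<close>

lemma sum_increments_le:
  fixes h :: "real \<Rightarrow> real" and a b :: "'i \<Rightarrow> real"
  assumes "finite J" "\<And>i. i \<in> J \<Longrightarrow> c \<le> a i \<and> a i < b i \<and> b i \<le> d"
    and "disjoint_family_on (\<lambda>i. {a i<..b i}) J" "c \<le> d" "mono_on {c..d} h"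
  shows "(\<Sum>i\<in>J. h (b i) - h (a i)) \<le> h d - h c"
  using assms
proof (induction "card J" arbitrary: J d)
  case 0
  then show ?case
    by (auto intro: mono_onD)
next
  case (Suc n)
  have "Max (a ` J) \<in> a ` J"
    using Suc.hyps(2) Suc.prems(1) by (intro Max_in) auto
  then obtain i where i: "i \<in> J" and "Max (a ` J) = a i"
    by auto
  then have max: "a j \<le> a i" if "j \<in> J" for j
    using Suc.prems(1) that Max_ge[of "a ` J" "a j"] by auto
  have left: "b j \<le> a i" if "j \<in> J - {i}" for j
  proof (rule ccontr)
    assume "\<not> b j \<le> a i"
    \<comment> \<open>As the intervals are closed on the right, the smaller right endpoint would
      belong to both.\<close>
    then have "min (b i) (b j) \<in> {a i<..b i} \<inter> {a j<..b j}"
      using max[of j] Suc.prems(2)[of i] Suc.prems(2)[of j] i that by auto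
    then show False
      using Suc.prems(3) i that unfolding disjoint_family_on_def by blast
  qed
  have bounds: "c \<le> a i" "a i < b i" "b i \<le> d"
    using Suc.prems(2)[OF i] by auto
  have "(\<Sum>j\<in>J - {i}. h (b j) - h (a j)) \<le> h (a i) - h c"
  proof (rule Suc.hyps(1))
    show "n = card (J - {i})"
      using Suc.hyps(2) Suc.prems(1) i by simp
    show "disjoint_family_on (\<lambda>i. {a i<..b i}) (J - {i})"
      using Suc.prems(3) by (rule disjoint_family_on_mono[rotated]) auto
    show "mono_on {c..a i} h"
      using Suc.prems(5) by (rule mono_on_subset) (use bounds in auto)
  qed (use Suc.prems left bounds in auto)
  moreover have "h (b i) \<le> h d"
    using Suc.prems(5) by (rule mono_onD) (use bounds in auto)
  ultimately show ?case
    using sum.remove[OF Suc.prems(1) i, of "\<lambda>j. h (b j) - h (a j)"] by linarith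
qed

text \<open>Both \<open>t + h t\<close> and \<open>t - h t\<close> are nondecreasing when
  \<open>h\<close> is 1-Lipschitz, and \<open>sum_increments_le\<close> for the two gives the two
  signs. The error is thus at most the length left uncovered.\<close>

lemma sum_increments_deviation:
  fixes h :: "real \<Rightarrow> real" and a b :: "'i \<Rightarrow> real"
  assumes J: "finite J" "\<And>i. i \<in> J \<Longrightarrow> c \<le> a i \<and> a i < b i \<and> b i \<le> d"
    "disjoint_family_on (\<lambda>i. {a i<..b i}) J" "c \<le> d"
    and h: "1-lipschitz_on {c..d} h"
  shows "\<bar>h d - h c - (\<Sum>i\<in>J. h (b i) - h (a i))\<bar> \<le> (d - c) - (\<Sum>i\<in>J. b i - a i)"
proof -
  have le: "\<bar>h s - h t\<bar> \<le> t - s" if "s \<in> {c..d}" "t \<in> {c..d}" "s \<le> t" for s t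
    using lipschitz_onD[OF h that(1,2)] that(3) by (simp add: dist_real_def)
  have plus: "mono_on {c..d} (\<lambda>t. t + h t)"
    by (rule mono_onI) (use le in \<open>fastforce simp: abs_le_iff\<close>)
  have minus: "mono_on {c..d} (\<lambda>t. t - h t)"
    by (rule mono_onI) (use le in \<open>fastforce simp: abs_le_iff\<close>)
  have "(\<Sum>i\<in>J. (b i + h (b i)) - (a i + h (a i))) \<le> (d + h d) - (c + h c)"
    by (rule sum_increments_le[where h = "\<lambda>t. t + h t", OF J plus])
  moreover have "(\<Sum>i\<in>J. (b i - h (b i)) - (a i - h (a i))) \<le> (d - h d) - (c - h c)"
    by (rule sum_increments_le[where h = "\<lambda>t. t - h t", OF J minus])
  ultimately show ?thesis
    by (simp add: sum.distrib sum_subtractf abs_le_iff)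
qed

section \<open>Clusters of a thin subset of a tree\<close>

text \<open>The union of finite \<open>1 / Suc n\<close>-nets; it serves to count the
  clusters.\<close>

lemma compact_countable_dense:
  fixes M :: "'a::metric_space set"
  assumes "compact M"
  obtains D where "countable D" "D \<subseteq> M" "\<And>x r. x \<in> M \<Longrightarrow> 0 < r \<Longrightarrow> \<exists>y\<in>D. dist x y < r"
proof -
  have "\<exists>k. finite k \<and> k \<subseteq> M \<and> M \<subseteq> (\<Union>x\<in>k. ball x (1 / Suc n))" for n :: nat
    using compact_imp_seq_compact[OF assms, THEN seq_compact_imp_totally_bounded] by simp
  then obtain k where k: "\<And>n. finite (k n)" "\<And>n. k n \<subseteq> M"
    "\<And>n::nat. M \<subseteq> (\<Union>x\<in>k n. ball x (1 / Suc n))"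
    by metis
  show thesis
  proof
    show "countable (\<Union>n. k n)"
      using k(1) by (simp add: countable_finite)
    show "(\<Union>n. k n) \<subseteq> M"
      using k(2) by blast
    fix x and r :: real assume x: "x \<in> M" and "0 < r"
    then obtain n where n: "1 / Suc n < r"
      using nat_approx_posE by metis
    obtain y where "y \<in> k n" "dist y x < 1 / Suc n"
      using k(3)[of n] x by auto
    then show "\<exists>y\<in>\<Union>n. k n. dist x y < r"
      using n by (intro bexI[of _ y]) (auto simp: dist_commute)
  qed
qed

section \<open>Gromov products based at the root\<close>

definition gromov :: "'a::metric_space \<Rightarrow> 'a \<Rightarrow> 'a \<Rightarrow> real" where
  "gromov z x y = (dist z x + dist z y - dist x y) / 2"

lemma gromov_commute: "gromov z x y = gromov z y x"
  by (simp add: gromov_def dist_commute)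

lemma gromov_self [simp]: "gromov z x x = dist z x"
  by (simp add: gromov_def)

lemma gromov_base [simp]: "gromov z x z = 0"
  by (simp add: gromov_def dist_commute)

lemma gromov_nonneg: "0 \<le> gromov z x y"
  using dist_triangle[of x y z] by (simp add: gromov_def dist_commute)

lemma gromov_le: "gromov z x y \<le> dist z x" "gromov z x y \<le> dist z y"
  using dist_triangle[of z y x] dist_triangle[of z x y] by (simp_all add: gromov_def dist_commute)

lemma gromov_ge: "dist z x - dist x y \<le> gromov z x y"
  using dist_triangle[of z x y] by (simp add: gromov_def dist_commute)

lemma continuous_on_gromov [continuous_intros]: "continuous_on S (gromov z x)"
  unfolding gromov_def by (intro continuous_intros) auto

text \<open>In a tree, \<^term>\<open>gromov z x y\<close> is the length of the common part of the segments from the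
  root \<open>z\<close> to \<open>x\<close> and to \<open>y\<close>. Hence \<open>branch x t\<close> consists of the points of \<open>M\<close> lying beyond the
  point at height \<open>t\<close> on the segment from \<open>z\<close> to \<open>x\<close>, and \<open>trace x\<close> is the set of heights at which
  that segment meets \<open>M\<close>.\<close>

locale thin_tree =
  fixes M :: "'a::metric_space set" and z :: 'a
  assumes compact: "compact M" and base: "z \<in> M"
    and ultra: "\<And>x y w. x \<in> M \<Longrightarrow> y \<in> M \<Longrightarrow> w \<in> M \<Longrightarrow>
      min (gromov z x w) (gromov z w y) \<le> gromov z x y"
    and negligible_trace: "\<And>x. x \<in> M \<Longrightarrow>
      negligible (dist z ` {y \<in> M. gromov z x y = dist z y})"
begin

definition branch :: "'a \<Rightarrow> real \<Rightarrow> 'a set" where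
  "branch x t = {y \<in> M. t \<le> gromov z x y}"

definition trace :: "'a \<Rightarrow> real set" where
  "trace x = dist z ` {y \<in> M. gromov z x y = dist z y}"

text \<open>The bounds on \<open>t\<close> keep the root out and \<open>x\<close> in; excluding
  \<open>trace x\<close> makes the branch relatively open in \<open>M\<close>
  (\<open>cluster_open\<close>).\<close>

definition clusters :: "'a set set" where
  "clusters = {branch x t | x t. x \<in> M \<and> 0 < t \<and> t \<le> dist z x \<and> t \<notin> trace x}"

definition heights :: "'a set \<Rightarrow> real set" where
  "heights A = {t. \<exists>x\<in>A. branch x t = A}"

definition lower :: "'a set \<Rightarrow> real" where
  "lower A = Inf (heights A)"

definition upper :: "'a set \<Rightarrow> real" where
  "upper A = Sup (heights A)"

text \<open>By \<open>ultra\<close>, the relation \<open>t \<le> gromov z x y\<close> is symmetric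
  and transitive on \<open>M\<close>, so branches at one height are equal or disjoint.\<close>

lemma branch_eq:
  assumes "x \<in> M" "y \<in> branch x t"
  shows "branch y t = branch x t"
  using assms ultra[of x _ y] ultra[of y _ x] gromov_commute[of z x y]
  by (fastforce simp: branch_def)

lemma clusters_subset: "A \<in> clusters \<Longrightarrow> A \<subseteq> M"
  by (auto simp: clusters_def branch_def)

lemma cluster_nonempty:
  assumes "A \<in> clusters"
  obtains x where "x \<in> A"
  using assms by (force simp: clusters_def branch_def)

lemma base_notin_cluster: "A \<in> clusters \<Longrightarrow> z \<notin> A"
  by (auto simp: clusters_def branch_def)

text \<open>By \<open>branch_eq\<close>, the existential in \<open>heights\<close> does not depend
  on the point of \<open>A\<close>, so any convenient point may be used.\<close>

lemma branch_eq_cluster_iff: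
  assumes "A \<in> clusters" "x \<in> A"
  shows "branch x t = A \<longleftrightarrow> t \<in> heights A"
proof
  assume "t \<in> heights A"
  then obtain y where y: "y \<in> A" "branch y t = A"
    by (auto simp: heights_def)
  then show "branch x t = A"
    using branch_eq[of y x t] assms clusters_subset by auto
qed (use assms in \<open>auto simp: heights_def\<close>)

text \<open>A point of \<open>A\<close> at height exactly \<open>t\<close> would put
  \<open>t\<close> into \<open>trace w\<close>. So \<open>x\<close> lies strictly higher, and by
  \<open>gromov_ge\<close> the slack \<open>dist z x - t\<close> is a radius that works.\<close>

lemma cluster_open:
  assumes "A \<in> clusters" "x \<in> A"
  shows "\<exists>r>0. \<forall>y\<in>M. dist x y < r \<longrightarrow> y \<in> A"
proof -
  obtain w t where w: "w \<in> M" "t \<notin> trace w" and A: "A = branch w t"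
    using assms(1) by (auto simp: clusters_def)
  have x: "x \<in> M" "t \<le> gromov z w x"
    using assms(2) by (auto simp: A branch_def)
  have "t < dist z x"
  proof (rule ccontr)
    assume "\<not> t < dist z x"
    then have "dist z x = t" "gromov z w x = t"
      using x(2) gromov_le(2)[of z w x] by auto
    then show False
      using w(2) x(1) by (auto simp: trace_def)
  qed
  moreover have "y \<in> A" if "y \<in> M" "dist x y < dist z x - t" for y
  proof -
    have "y \<in> branch x t"
      using gromov_ge[of z x y] that by (simp add: branch_def)
    then show ?thesis
      using branch_eq[of w x t] w assms(2) A by simp
  qed
  ultimately show ?thesis
    by (intro exI[of _ "dist z x - t"]) auto
qed

text \<open>Both \<open>A\<close> and \<open>M - A\<close> are compact, so \<open>gromov z w\<close>
  has a maximum on \<open>M - A\<close> and a minimum on \<open>A\<close>. The branch of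
  \<open>w\<close> at \<open>s\<close> is \<open>A\<close> exactly when \<open>s\<close> exceeds the
  first and is at most the second.\<close>

lemma heights_interval:
  assumes "A \<in> clusters"
  shows "\<exists>a b. 0 \<le> a \<and> a < b \<and> heights A = {a<..b}"
proof -
  obtain w t where w: "w \<in> M" "0 < t" "t \<le> dist z w" and A: "A = branch w t"
    using assms by (auto simp: clusters_def)
  have wA: "w \<in> A"
    using w by (simp add: A branch_def)
  obtain r where r: "\<And>x. x \<in> A \<Longrightarrow> 0 < r x"
    "\<And>x y. x \<in> A \<Longrightarrow> y \<in> M \<Longrightarrow> dist x y < r x \<Longrightarrow> y \<in> A"
    using cluster_open[OF assms] by metis
  have "M - (\<Union>x\<in>A. ball x (r x)) = M - A"
    using r clusters_subset[OF assms] by fastforce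
  then have "compact (M - A)"
    using compact_diff[OF compact, of "\<Union>x\<in>A. ball x (r x)"] by auto
  moreover have "z \<in> M - A"
    using base base_notin_cluster[OF assms] by blast
  ultimately obtain p where p: "p \<in> M - A" "\<And>y. y \<in> M - A \<Longrightarrow> gromov z w y \<le> gromov z w p"
    using continuous_attains_sup[of "M - A" "gromov z w"] continuous_on_gromov by blast
  have "open {y. gromov z w y < t}"
    using continuous_on_gromov by (intro open_Collect_less) auto
  then have "compact (M - {y. gromov z w y < t})"
    by (rule compact_diff[OF compact])
  moreover have "M - {y. gromov z w y < t} = A"
    by (auto simp: A branch_def)
  ultimately have "compact A"
    by simp
  then obtain q where q: "q \<in> A" "\<And>y. y \<in> A \<Longrightarrow> gromov z w q \<le> gromov z w y"
    using continuous_attains_inf[of A "gromov z w"] continuous_on_gromov wA by blast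
  \<comment> \<open>The defining height \<open>t\<close> separates the two extrema, so the interval
    is nonempty.\<close>
  have "gromov z w p < t" "t \<le> gromov z w q"
    using p(1) q(1) by (auto simp: A branch_def)
  moreover have "branch w s = A \<longleftrightarrow> s \<in> {gromov z w p<..gromov z w q}" for s
  proof
    assume "branch w s = A"
    then show "s \<in> {gromov z w p<..gromov z w q}"
      using p(1) q(1) by (auto simp: branch_def)
  next
    assume s: "s \<in> {gromov z w p<..gromov z w q}"
    have "y \<in> branch w s \<longleftrightarrow> y \<in> A" if "y \<in> M" for y
      using s that p(2)[of y] q(2)[of y] by (cases "y \<in> A") (auto simp: branch_def)
    then show "branch w s = A"
      using clusters_subset[OF assms] by (auto simp: branch_def)
  qed
  ultimately show ?thesis
    using branch_eq_cluster_iff[OF assms wA] gromov_nonneg[of z w p]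
    by (intro exI[of _ "gromov z w p"] exI[of _ "gromov z w q"]) auto
qed

lemma cluster_interval:
  assumes "A \<in> clusters"
  shows heights_eq: "heights A = {lower A<..upper A}"
    and lower_nonneg: "0 \<le> lower A"
    and lower_less_upper: "lower A < upper A"
proof -
  obtain a b where ab: "0 \<le> a" "a < b" "heights A = {a<..b}"
    using heights_interval[OF assms] by blast
  then have "lower A = a" "upper A = b"
    by (simp_all add: lower_def upper_def)
  then show "heights A = {lower A<..upper A}" "0 \<le> lower A" "lower A < upper A"
    using ab by auto
qed

lemma upper_le_gromov:
  assumes "A \<in> clusters" "x \<in> A" "y \<in> A"
  shows "upper A \<le> gromov z x y"
proof -
  have "branch x (upper A) = A"
    using branch_eq_cluster_iff[OF assms(1,2)] cluster_interval[OF assms(1)] by simp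
  then show ?thesis
    using assms(3) by (auto simp: branch_def)
qed

lemma gromov_le_lower:
  assumes "A \<in> clusters" "x \<in> A" "y \<in> M" "y \<notin> A"
  shows "gromov z x y \<le> lower A"
proof (rule ccontr)
  assume "\<not> ?thesis"
  \<comment> \<open>Capping at \<open>upper A\<close> yields a height of \<open>A\<close> at which
    the branch of \<open>x\<close> would also contain \<open>y\<close>.\<close>
  then have "min (gromov z x y) (upper A) \<in> heights A"
    using cluster_interval[OF assms(1)] by simp
  then have "branch x (min (gromov z x y) (upper A)) = A"
    using branch_eq_cluster_iff[OF assms(1,2)] by simp
  moreover have "y \<in> branch x (min (gromov z x y) (upper A))"
    using assms(3) by (simp add: branch_def)
  ultimately show False
    using assms(4) by blast
qed

section \<open>Total length of the clusters around a point\<close>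

lemma disjoint_heights:
  assumes "A \<in> clusters" "B \<in> clusters" "x \<in> A" "x \<in> B" "A \<noteq> B"
  shows "heights A \<inter> heights B = {}"
  using branch_eq_cluster_iff[OF assms(1,3)] branch_eq_cluster_iff[OF assms(2,4)] assms(5) by blast

lemma disjoint_family_heights:
  assumes "F \<subseteq> clusters" "\<And>A. A \<in> F \<Longrightarrow> x \<in> A"
  shows "disjoint_family_on (\<lambda>A. {lower A<..upper A}) F"
  unfolding disjoint_family_on_def
  using assms disjoint_heights[of _ _ x] heights_eq by (metis subsetD)

text \<open>The height intervals of clusters that contain \<open>x\<close> but not \<open>y\<close>
  are disjoint and lie beyond the branching height \<open>gromov z x y\<close>, on the way up to
  \<open>x\<close>.\<close>

lemma sum_length_separating:
  assumes F: "finite F" "F \<subseteq> clusters" "\<And>A. A \<in> F \<Longrightarrow> x \<in> A \<and> y \<notin> A" and "y \<in> M"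
  shows "(\<Sum>A\<in>F. upper A - lower A) \<le> dist z x - gromov z x y"
proof (rule sum_increments_le[where h = "\<lambda>t. t"])
  fix A assume A: "A \<in> F"
  then have "A \<in> clusters" "x \<in> A" "y \<notin> A"
    using F by auto
  then show "gromov z x y \<le> lower A \<and> lower A < upper A \<and> upper A \<le> dist z x"
    using gromov_le_lower[of A x y] lower_less_upper[of A] upper_le_gromov[of A x x] assms(4)
    by simp
next
  show "disjoint_family_on (\<lambda>A. {lower A<..upper A}) F"
    using F by (intro disjoint_family_heights[where x = x]) auto
qed (use F gromov_le in \<open>auto intro: mono_onI\<close>)

text \<open>\<open>d(x, y)\<close> is the sum of \<open>d(z, x) - (x|y)\<close> and \<open>d(z, y) - (x|y)\<close>.\<close>

lemma sum_length_le_dist: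
  assumes F: "finite F" "F \<subseteq> clusters" and xy: "x \<in> M" "y \<in> M"
  shows "(\<Sum>A\<in>F. (upper A - lower A) * \<bar>indicat_real A x - indicat_real A y\<bar>) \<le> dist x y"
proof -
  \<comment> \<open>Only clusters separating \<open>x\<close> from \<open>y\<close> contribute; they
    are sorted by which of the two points they contain.\<close>
  have "(\<Sum>A\<in>F. (upper A - lower A) * \<bar>indicat_real A x - indicat_real A y\<bar>)
      = (\<Sum>A\<in>F. (if x \<in> A \<and> y \<notin> A then upper A - lower A else 0)
          + (if y \<in> A \<and> x \<notin> A then upper A - lower A else 0))"
    by (intro sum.cong) (auto simp: indicator_def)
  also have "\<dots> = (\<Sum>A\<in>{A \<in> F. x \<in> A \<and> y \<notin> A}. upper A - lower A)
      + (\<Sum>A\<in>{A \<in> F. y \<in> A \<and> x \<notin> A}. upper A - lower A)"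
    using F(1) by (simp only: sum.distrib sum.inter_filter)
  also have "\<dots> \<le> (dist z x - gromov z x y) + (dist z y - gromov z y x)"
    using F xy by (intro add_mono sum_length_separating) auto
  also have "\<dots> = dist x y"
    by (simp add: gromov_def dist_commute[of y x] field_simps)
  finally show ?thesis .
qed

text \<open>A cluster is relatively open, so it contains a point of a countable dense set, and its
  interval of heights contains a rational; the two determine it.\<close>

lemma countable_clusters: "countable clusters"
proof -
  obtain D where D: "countable D" "D \<subseteq> M" "\<And>x r. x \<in> M \<Longrightarrow> 0 < r \<Longrightarrow> \<exists>y\<in>D. dist x y < r"
    using compact_countable_dense[OF compact] by blast
  have "A \<in> (\<lambda>(x, t). branch x t) ` (D \<times> \<rat>)" if A: "A \<in> clusters" for A
  proof -
    obtain x where x: "x \<in> A"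
      using cluster_nonempty[OF A] .
    then obtain r where "r > 0" and r: "\<And>y. y \<in> M \<Longrightarrow> dist x y < r \<Longrightarrow> y \<in> A"
      using cluster_open[OF A] by blast
    then obtain y where y: "y \<in> D" "y \<in> A"
      using D(2) D(3)[of x r] x clusters_subset[OF A] by blast
    obtain q where q: "q \<in> \<rat>" "lower A < q" "q < upper A"
      using Rats_dense_in_real[OF lower_less_upper[OF A]] by blast
    then have "branch y q = A"
      using branch_eq_cluster_iff[OF A y(2)] heights_eq[OF A] by simp
    then show ?thesis
      using y q by force
  qed
  then have "clusters \<subseteq> (\<lambda>(x, t). branch x t) ` (D \<times> \<rat>)"
    by blast
  then show ?thesis
    by (rule countable_subset) (intro countable_image countable_SIGMA D(1) countable_rat)
qed

text \<open>The McShane extension of \<open>f\<close> to the whole tree, evaluated at the point \<open>p\<close> at height \<open>t\<close> on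
  the segment from \<open>z\<close> to \<open>x\<close>: the distance from \<open>p\<close> to \<open>y\<close> is
  \<open>d(z, y) + t - 2 min (x|y) t\<close>.\<close>

definition extension :: "('a \<Rightarrow> real) \<Rightarrow> 'a \<Rightarrow> real \<Rightarrow> real" where
  "extension f x t = (INF y\<in>M. f y + dist z y + t - 2 * min (gromov z x y) t)"

text \<open>The increment of the extension over the segment of \<open>A\<close>, not yet divided by
  its length. The arbitrary choice of \<open>x\<close> is justified by
  \<open>slope_eq\<close>.\<close>

definition slope :: "('a \<Rightarrow> real) \<Rightarrow> 'a set \<Rightarrow> real" where
  "slope f A = (let x = SOME x. x \<in> A in extension f x (upper A) - extension f x (lower A))"

section \<open>Increments of a 1-Lipschitz function along the tree\<close>

context
  fixes f :: "'a \<Rightarrow> real"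
  assumes lip: "1-lipschitz_on M f" and f_base: "f z = 0"
begin

lemma abs_diff_le_dist: "x \<in> M \<Longrightarrow> y \<in> M \<Longrightarrow> \<bar>f x - f y\<bar> \<le> dist x y"
  using lipschitz_onD[OF lip, of x y] by (simp add: dist_real_def)

lemma neg_dist_le: "y \<in> M \<Longrightarrow> - dist z y \<le> f y"
  using abs_diff_le_dist[OF base, of y] f_base by auto

lemma extension_bdd_below: "bdd_below ((\<lambda>y. f y + dist z y + t - 2 * min (gromov z x y) t) ` M)"
proof (rule bdd_belowI2)
  show "- t \<le> f y + dist z y + t - 2 * min (gromov z x y) t" if "y \<in> M" for y
    using neg_dist_le[OF that] by linarith
qed

lemma extension_le: "y \<in> M \<Longrightarrow> extension f x t \<le> f y + dist z y + t - 2 * min (gromov z x y) t"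
  unfolding extension_def by (rule cINF_lower[OF extension_bdd_below])

lemma extension_greatest:
  "(\<And>y. y \<in> M \<Longrightarrow> c \<le> f y + dist z y + t - 2 * min (gromov z x y) t) \<Longrightarrow> c \<le> extension f x t"
  unfolding extension_def using base by (intro cINF_greatest) auto

text \<open>Each term of the infimum is 1-Lipschitz in \<open>t\<close>, having slope -1 up to
  \<open>gromov z x y\<close> and 1 afterwards.\<close>

lemma lipschitz_extension: "1-lipschitz_on S (extension f x)"
proof (rule lipschitz_onI)
  have le: "extension f x s - \<bar>s - t\<bar> \<le> extension f x t" for s t
  proof (rule extension_greatest)
    show "extension f x s - \<bar>s - t\<bar> \<le> f y + dist z y + t - 2 * min (gromov z x y) t"
      if "y \<in> M" for y
      using extension_le[OF that, of x s] by linarith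
  qed
  show "dist (extension f x s) (extension f x t) \<le> 1 * dist s t" for s t
    using le[of s t] le[of t s] by (simp add: dist_real_def)
qed simp

lemma extension_0: "extension f x 0 = 0"
proof (rule antisym)
  show "extension f x 0 \<le> 0"
    using extension_le[OF base, of x 0] f_base by simp
  show "0 \<le> extension f x 0"
  proof (rule extension_greatest)
    show "0 \<le> f y + dist z y + 0 - 2 * min (gromov z x y) 0" if "y \<in> M" for y
      using neg_dist_le[OF that] gromov_nonneg[of z x y] by simp
  qed
qed

text \<open>At the top height the term of \<open>y\<close> becomes \<open>f y + dist x y\<close>,
  which is at least \<open>f x\<close>, with equality for \<open>y = x\<close>.\<close>

lemma extension_dist:
  assumes "x \<in> M"
  shows "extension f x (dist z x) = f x"
proof (rule antisym)
  show "extension f x (dist z x) \<le> f x"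
    using extension_le[OF assms, of x "dist z x"] by simp
  show "f x \<le> extension f x (dist z x)"
  proof (rule extension_greatest)
    show "f x \<le> f y + dist z y + dist z x - 2 * min (gromov z x y) (dist z x)" if "y \<in> M" for y
      using abs_diff_le_dist[OF assms that] gromov_le(1)[of z x y]
      by (simp add: min_absorb1) (simp add: gromov_def field_simps)
  qed
qed

text \<open>Up to height \<open>gromov z x x'\<close> the paths from the root to \<open>x\<close>
  and \<open>x'\<close> coincide; by \<open>ultra\<close> the Gromov products with any
  \<open>y\<close>, truncated at \<open>t\<close>, agree.\<close>

lemma extension_cong:
  assumes "x \<in> M" "x' \<in> M" "t \<le> gromov z x x'"
  shows "extension f x t = extension f x' t"
proof -
  have "min (gromov z x y) t = min (gromov z x' y) t" if "y \<in> M" for y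
    using ultra[of x y x'] ultra[of x' y x] assms that gromov_commute[of z x x'] by linarith
  then show ?thesis
    unfolding extension_def by (intro INF_cong) auto
qed

lemma slope_eq:
  assumes "A \<in> clusters" "x \<in> A"
  shows "slope f A = extension f x (upper A) - extension f x (lower A)"
proof -
  define x' where "x' = (SOME x. x \<in> A)"
  have x': "x' \<in> A"
    unfolding x'_def using assms(2) by (rule someI)
  have "upper A \<le> gromov z x' x"
    by (rule upper_le_gromov[OF assms(1) x' assms(2)])
  then have "extension f x' t = extension f x t" if "t \<le> upper A" for t
    using that x' assms clusters_subset by (intro extension_cong) auto
  then show ?thesis
    using lower_less_upper[OF assms(1)] by (simp add: slope_def x'_def[symmetric] Let_def)
qed

lemma abs_slope_le:
  assumes "A \<in> clusters"
  shows "\<bar>slope f A\<bar> \<le> upper A - lower A"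
proof -
  obtain x where "x \<in> A"
    using cluster_nonempty[OF assms] .
  then show ?thesis
    using slope_eq[OF assms] lower_less_upper[OF assms]
      lipschitz_onD[OF lipschitz_extension[of UNIV x], of "upper A" "lower A"]
    by (simp add: dist_real_def)
qed

text \<open>The extension rises from 0 at the root to \<open>f x\<close> at height
  \<open>dist z x\<close>, so \<open>sum_increments_deviation\<close> applies to the whole
  path.\<close>

lemma sum_slope_deviation:
  assumes F: "finite F" "F \<subseteq> clusters" "\<And>A. A \<in> F \<Longrightarrow> x \<in> A" and x: "x \<in> M"
  shows "\<bar>f x - (\<Sum>A\<in>F. slope f A)\<bar> \<le> dist z x - (\<Sum>A\<in>F. upper A - lower A)"
proof -
  have "(\<Sum>A\<in>F. slope f A) = (\<Sum>A\<in>F. extension f x (upper A) - extension f x (lower A))"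
    using F by (intro sum.cong slope_eq) auto
  moreover have "0 \<le> lower A \<and> lower A < upper A \<and> upper A \<le> dist z x" if "A \<in> F" for A
    using that F(2) F(3)[OF that] lower_nonneg[of A] lower_less_upper[of A] upper_le_gromov[of A x x]
    by auto
  ultimately show ?thesis
    using sum_increments_deviation[OF F(1), of 0 lower upper "dist z x" "extension f x"]
      disjoint_family_heights[OF F(2,3)] lipschitz_extension extension_0 extension_dist[OF x]
    by simp
qed

end

section \<open>Exhaustion of the paths from the root and the resulting expansion\<close>

lemma dist_base_sums:
  assumes x: "x \<in> M" and A: "bij_betw A N clusters"
  shows "(\<lambda>n::nat. if n \<in> N then (upper (A n) - lower (A n)) * indicat_real (A n) x else 0)
    sums dist z x"
proof -
  define I where "I n = (if n \<in> N \<and> x \<in> A n then {lower (A n)<..upper (A n)} else {})" for n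
  have mem: "A n \<in> clusters" if "n \<in> N" for n
    using A that by (auto simp: bij_betw_def)
  have "disjoint_family I"
    unfolding disjoint_family_on_def I_def
    using disjoint_heights[of "A _" "A _" x] heights_eq mem bij_betw_imp_inj_on[OF A]
    by (auto simp: inj_on_def) metis+
  moreover have sub: "I n \<subseteq> {0<..dist z x}" for n
    using upper_le_gromov[of "A n" x x] lower_nonneg[of "A n"] mem[of n] by (auto simp: I_def)
  moreover have "emeasure lebesgue (\<Union>n. I n) \<noteq> \<infinity>"
  proof -
    have "emeasure lebesgue (\<Union>n. I n) \<le> emeasure lebesgue {0<..dist z x}"
      using sub by (intro emeasure_mono) auto
    then show ?thesis
      by (auto simp: top_unique)
  qed
  moreover have "range I \<subseteq> sets lebesgue"
    by (auto simp: I_def)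
  ultimately have "(\<lambda>n. measure lebesgue (I n)) sums measure lebesgue (\<Union>n. I n)"
    by (intro measure_UNION) auto
  moreover have "measure lebesgue (\<Union>n. I n) = measure lebesgue {0<..dist z x}"
  proof (rule measure_negligible_symdiff)
    \<comment> \<open>A height outside the null set \<open>trace x\<close> cuts off a cluster around
      \<open>x\<close>, and so lies in the interval of that cluster.\<close>
    have cover: "t \<in> (\<Union>n. I n) \<union> trace x" if t: "t \<in> {0<..dist z x}" for t
    proof (cases "t \<in> trace x")
      case False
      then have B: "branch x t \<in> clusters"
        using x t by (auto simp: clusters_def)
      have "x \<in> branch x t"
        using x t by (simp add: branch_def)
      then have "t \<in> heights (branch x t)"
        using branch_eq_cluster_iff[OF B] by blast
      moreover obtain n where "n \<in> N" "A n = branch x t"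
        using A B by (metis bij_betwE bij_betw_imp_surj_on imageE)
      ultimately have "t \<in> I n"
        using heights_eq[OF B] \<open>x \<in> branch x t\<close> by (simp add: I_def)
      then show ?thesis
        by blast
    qed simp
    have "({0<..dist z x} - (\<Union>n. I n)) \<union> ((\<Union>n. I n) - {0<..dist z x}) \<subseteq> trace x"
      using cover sub by blast
    then show "negligible (({0<..dist z x} - (\<Union>n. I n)) \<union> ((\<Union>n. I n) - {0<..dist z x}))"
      using negligible_trace[OF x] negligible_subset unfolding trace_def by blast
  qed (simp add: fmeasurable_def)
  moreover have "measure lebesgue (I n)
      = (if n \<in> N then (upper (A n) - lower (A n)) * indicat_real (A n) x else 0)" for n
    using lower_less_upper[OF mem[of n]] by (auto simp: I_def)
  ultimately show ?thesis
    by simp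
qed

lemma cut_decomposition:
  obtains e :: "nat \<Rightarrow> 'a \<Rightarrow> real" where
    "\<And>n. e n z = 0"
    "\<And>n x. x \<notin> M \<Longrightarrow> e n x = 0"
    "\<And>K x y. x \<in> M \<Longrightarrow> y \<in> M \<Longrightarrow> (\<Sum>n<K. \<bar>e n x - e n y\<bar>) \<le> dist x y"
    "\<And>f. 1-lipschitz_on M f \<Longrightarrow> f z = 0 \<Longrightarrow>
      \<exists>\<sigma>. (\<forall>n. \<bar>\<sigma> n\<bar> \<le> 1) \<and> (\<forall>x\<in>M. (\<lambda>n. \<sigma> n * e n x) sums f x)"
proof -
  obtain g :: "'a set \<Rightarrow> nat" where g: "inj_on g clusters"
    using countable_clusters by (auto simp: countable_def)
  define N where "N = g ` clusters"
  define A where "A = inv_into clusters g"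
  have bij: "bij_betw A N clusters"
    unfolding A_def N_def by (intro bij_betw_inv_into inj_on_imp_bij_betw g)
  then have inj: "inj_on A N" and mem: "\<And>n. n \<in> N \<Longrightarrow> A n \<in> clusters"
    by (auto simp: bij_betw_def)
  \<comment> \<open>The value 0 off \<open>N\<close> treats finite and infinite families of clusters
    alike.\<close>
  define e where "e n x = (if n \<in> N then (upper (A n) - lower (A n)) * indicat_real (A n) x else 0)"
    for n x
  show thesis
  proof
    show "e n z = 0" for n
      using base_notin_cluster mem by (simp add: e_def)
    show "e n x = 0" if "x \<notin> M" for n x
      using clusters_subset[OF mem] that by (auto simp: e_def indicator_def)
    show "(\<Sum>n<K. \<bar>e n x - e n y\<bar>) \<le> dist x y" if xy: "x \<in> M" "y \<in> M" for K x y
    proof -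
      define w where "w B = (upper B - lower B) * \<bar>indicat_real B x - indicat_real B y\<bar>" for B
      have "\<bar>e n x - e n y\<bar> = w (A n)" if "n \<in> N" for n
        using lower_less_upper[OF mem[OF that]] that
        by (simp add: e_def w_def abs_mult flip: right_diff_distrib)
      then have "(\<Sum>n<K. \<bar>e n x - e n y\<bar>) = (\<Sum>n\<in>{..<K} \<inter> N. w (A n))"
        by (intro sum.mono_neutral_cong_right) (auto simp: e_def)
      also have "\<dots> = (\<Sum>B\<in>A ` ({..<K} \<inter> N). w B)"
        using inj by (subst sum.reindex) (auto simp: inj_on_def)
      also have "\<dots> \<le> dist x y"
        unfolding w_def using mem by (intro sum_length_le_dist xy) auto
      finally show ?thesis .
    qed
    fix f :: "'a \<Rightarrow> real"
    assume f: "1-lipschitz_on M f" "f z = 0"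
    \<comment> \<open>The mean slope over the segment: multiplied by \<open>e n x\<close> it returns
      the increment when \<open>x \<in> A n\<close>.\<close>
    define \<sigma> where "\<sigma> n = (if n \<in> N then slope f (A n) / (upper (A n) - lower (A n)) else 0)" for n
    have "\<bar>\<sigma> n\<bar> \<le> 1" for n
      using abs_slope_le[OF f mem[of n]] lower_less_upper[OF mem[of n]]
      by (auto simp: \<sigma>_def abs_divide)
    moreover have "(\<lambda>n. \<sigma> n * e n x) sums f x" if x: "x \<in> M" for x
    proof -
      \<comment> \<open>The error is at most the part of the path not yet covered, which tends to 0
        by \<open>dist_base_sums\<close>.\<close>
      have dev: "norm ((\<Sum>n<K. \<sigma> n * e n x) - f x) \<le> dist z x - (\<Sum>n<K. e n x)" for K
      proof -
        define J where "J = {n \<in> {..<K}. n \<in> N \<and> x \<in> A n}"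
        have injJ: "inj_on A J"
          using inj by (auto simp: J_def inj_on_def)
        have J: "finite (A ` J)" "A ` J \<subseteq> clusters" "\<And>B. B \<in> A ` J \<Longrightarrow> x \<in> B"
          using mem by (auto simp: J_def)
        have "\<sigma> n * e n x = slope f (A n)" if "n \<in> J" for n
          using that lower_less_upper[OF mem[of n]] by (simp add: J_def \<sigma>_def e_def)
        then have "(\<Sum>n<K. \<sigma> n * e n x) = (\<Sum>n\<in>J. slope f (A n))"
          by (intro sum.mono_neutral_cong_right) (auto simp: J_def e_def)
        then have 1: "(\<Sum>n<K. \<sigma> n * e n x) = (\<Sum>B\<in>A ` J. slope f B)"
          by (simp add: sum.reindex[OF injJ])
        have "(\<Sum>n<K. e n x) = (\<Sum>n\<in>J. upper (A n) - lower (A n))"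
          by (intro sum.mono_neutral_cong_right) (auto simp: J_def e_def)
        then have 2: "(\<Sum>n<K. e n x) = (\<Sum>B\<in>A ` J. upper B - lower B)"
          by (simp add: sum.reindex[OF injJ])
        show ?thesis
          using sum_slope_deviation[OF f J x] unfolding 1 2 by (simp add: abs_minus_commute)
      qed
      have "(\<lambda>K. dist z x - (\<Sum>n<K. e n x)) \<longlonglongrightarrow> 0"
        using tendsto_diff[OF tendsto_const[of "dist z x"] dist_base_sums[OF x bij, unfolded sums_def]]
        by (simp add: e_def)
      then have "(\<lambda>K. (\<Sum>n<K. \<sigma> n * e n x) - f x) \<longlonglongrightarrow> 0"
        by (rule Lim_null_comparison[OF always_eventually[OF allI[OF dev]]])
      then show ?thesis
        by (simp add: sums_def LIM_zero_iff)
    qed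
    ultimately show "\<exists>\<sigma>. (\<forall>n. \<bar>\<sigma> n\<bar> \<le> 1) \<and> (\<forall>x\<in>M. (\<lambda>n. \<sigma> n * e n x) sums f x)"
      by blast
  qed
qed

end

section \<open>Compact null subsets of real trees\<close>

lemma real_tree_four_point:
  assumes "real_tree T" "a \<in> T" "b \<in> T" "c \<in> T" "e \<in> T"
  shows "dist a b + dist c e \<le> max (dist a c + dist b e) (dist b c + dist a e)"
  using assms unfolding real_tree_def by blast

lemma real_tree_geodesic:
  assumes "real_tree T" "x \<in> T" "y \<in> T"
  obtains \<phi> where "geodesic T x y \<phi>"
  using assms unfolding real_tree_def by blast

lemma geodesic_geo:
  assumes "geodesic T x y \<phi>"
  shows "geodesic T x y (geo T x y)"
  unfolding geo_def by (rule someI[of _ \<phi>]) (rule assms)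

lemma segment_subset:
  assumes "real_tree T" "x \<in> T" "y \<in> T"
  shows "segment T x y \<subseteq> T"
proof -
  obtain \<phi> where "geodesic T x y \<phi>"
    using real_tree_geodesic[OF assms] .
  from geodesic_geo[OF this] show ?thesis
    by (auto simp: segment_def geodesic_def)
qed

text \<open>\<open>tree_length\<close> uses the geodesics chosen by \<open>geo\<close> inside
  \<open>tree_conv T M\<close>. The one chosen in \<open>T\<close> stays there, so the choice is
  from a nonempty set.\<close>

lemma geodesic_tree_conv:
  assumes "real_tree T" "M \<subseteq> T" "x \<in> M" "y \<in> M"
  shows "geodesic (tree_conv T M) x y (geo (tree_conv T M) x y)"
proof -
  obtain \<phi> where "geodesic T x y \<phi>"
    using real_tree_geodesic[OF assms(1), of x y] assms(2-4) by blast
  then have "geodesic T x y (geo T x y)"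
    by (rule geodesic_geo)
  moreover have "segment T x y \<subseteq> tree_conv T M"
    using assms(3,4) by (auto simp: tree_conv_def)
  ultimately have "geodesic (tree_conv T M) x y (geo T x y)"
    by (auto simp: geodesic_def segment_def)
  then show ?thesis
    by (rule geodesic_geo)
qed

lemma tree_conv_subset: "real_tree T \<Longrightarrow> M \<subseteq> T \<Longrightarrow> tree_conv T M \<subseteq> T"
  unfolding tree_conv_def using segment_subset by blast

lemma segment_measure_le_tree_measure:
  assumes "x \<in> T" "y \<in> T"
  shows "segment_measure T x y A \<le> tree_measure T A"
  unfolding tree_measure_def using assms
  by (intro SUP_upper2[of "{(x, y)}"]) (auto simp: disjoint_family_on_def)

lemma negligible_geodesic_preimage:
  assumes tree: "real_tree T" "M \<subseteq> T" and "compact M" and xy: "x \<in> M" "y \<in> M"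
    and "tree_length T M = 0"
  shows "negligible {t \<in> {0..dist x y}. geo (tree_conv T M) x y t \<in> M}" (is "negligible ?P")
proof -
  define \<gamma> where "\<gamma> = geo (tree_conv T M) x y"
  have \<gamma>: "geodesic (tree_conv T M) x y \<gamma>"
    unfolding \<gamma>_def by (rule geodesic_tree_conv[OF tree xy])
  then have ends: "x \<in> tree_conv T M" "y \<in> tree_conv T M"
    by (auto simp: geodesic_def Pi_iff dest: bspec[of _ _ 0] bspec[of _ _ "dist x y"])
  have "1-lipschitz_on {0..dist x y} \<gamma>"
    using \<gamma> by (intro lipschitz_onI) (auto simp: geodesic_def dist_real_def)
  then have "continuous_on {0..dist x y} \<gamma>"
    by (rule lipschitz_on_continuous_on)
  then have "closed ({0..dist x y} \<inter> \<gamma> -` M)"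
    using assms(3) by (intro continuous_closed_preimage compact_imp_closed) auto
  moreover have "?P = {0..dist x y} \<inter> \<gamma> -` M"
    by (auto simp: \<gamma>_def)
  \<comment> \<open>Measurability has to come first: \<open>emeasure\<close> is 0 on nonmeasurable
    sets by convention.\<close>
  ultimately have "?P \<in> sets lebesgue"
    by simp
  moreover have "emeasure lebesgue ?P = 0"
    using segment_measure_le_tree_measure[OF ends, of M] assms(6)
    by (simp add: tree_length_def segment_measure_def)
  ultimately show ?thesis
    by (simp add: negligible_iff_null_sets null_sets_def)
qed

lemma thin_tree_compact_subset:
  assumes tree: "real_tree T" "M \<subseteq> T" and "compact M" "z \<in> M" "tree_length T M = 0"
  shows "thin_tree M z"
proof
  fix x y w assume "x \<in> M" "y \<in> M" "w \<in> M"
  \<comment> \<open>The four-point condition with the root as fourth point is the ultrametric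
    inequality for Gromov products.\<close>
  then have "dist x y + dist w z \<le> max (dist x w + dist y z) (dist y w + dist x z)"
    using assms(2,4) by (intro real_tree_four_point[OF tree(1)]) auto
  then show "min (gromov z x w) (gromov z w y) \<le> gromov z x y"
    unfolding gromov_def dist_commute[of z] dist_commute[of w y] le_max_iff_disj min_le_iff_disj
    by (elim disj_forward) (simp_all add: divide_right_mono)
next
  fix x assume x: "x \<in> M"
  define \<gamma> where "\<gamma> = geo (tree_conv T M) z x"
  have \<gamma>: "geodesic (tree_conv T M) z x \<gamma>"
    unfolding \<gamma>_def by (rule geodesic_tree_conv[OF tree assms(4) x])
  \<comment> \<open>\<open>gromov z x y = dist z y\<close> says that \<open>y\<close> is metrically
    between \<open>z\<close> and \<open>x\<close>. The four-point condition then forces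
    \<open>y\<close> to be the point \<open>p\<close> of the geodesic at the same height.\<close>
  have "dist z ` {y \<in> M. gromov z x y = dist z y} \<subseteq> {t \<in> {0..dist z x}. \<gamma> t \<in> M}"
  proof clarify
    fix y assume y: "y \<in> M" and "gromov z x y = dist z y"
    then have xy: "dist x y = dist z x - dist z y" "dist z y \<le> dist z x"
      using gromov_le(1)[of z x y] by (auto simp: gromov_def)
    define p where "p = \<gamma> (dist z y)"
    have "p \<in> T"
      using \<gamma> xy tree_conv_subset[OF tree] by (auto simp: geodesic_def p_def)
    have ends: "\<gamma> 0 = z" "\<gamma> (dist z x) = x"
      using \<gamma> by (simp_all add: geodesic_def)
    have "dist (\<gamma> s) (\<gamma> t) = \<bar>s - t\<bar>" if "s \<in> {0..dist z x}" "t \<in> {0..dist z x}" for s t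
      using \<gamma> that by (simp add: geodesic_def)
    from this[of "dist z y" 0] this[of "dist z y" "dist z x"]
    have "dist p z = dist z y" "dist p x = dist z x - dist z y"
      using xy(2) unfolding ends p_def by simp_all
    then have "dist p y \<le> 0"
      using real_tree_four_point[OF tree(1) \<open>p \<in> T\<close>, of y z x] xy assms(2,4) x y
      by (auto simp: dist_commute)
    then show "dist z y \<in> {0..dist z x} \<and> \<gamma> (dist z y) \<in> M"
      using xy y by (simp add: p_def)
  qed
  then show "negligible (dist z ` {y \<in> M. gromov z x y = dist z y})"
    using negligible_geodesic_preimage[OF tree assms(3,4) x assms(5)] negligible_subset
    unfolding \<gamma>_def by blast
qed (use assms in auto)

theorem proposition8:
  fixes T M :: "'a::metric_space set" and z :: 'a
  assumes "real_tree T"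
    and "M \<subseteq> T"
    and "compact M"
    and "z \<in> M"
    and "tree_length T M = 0"
  shows "\<exists>S U. S \<subseteq> l1 \<and> fun_subspace S \<and>
           linear_isometry_between (free_space M z) (dual_norm M z) S l1_norm U"
proof -
  interpret thin_tree M z
    using assms by (rule thin_tree_compact_subset)
  show ?thesis
  proof (rule cut_decomposition)
    fix e :: "nat \<Rightarrow> 'a \<Rightarrow> real"
    assume "\<And>n. e n z = 0" "\<And>n x. x \<notin> M \<Longrightarrow> e n x = 0"
      "\<And>K x y. x \<in> M \<Longrightarrow> y \<in> M \<Longrightarrow> (\<Sum>n<K. \<bar>e n x - e n y\<bar>) \<le> dist x y"
      "\<And>f. 1-lipschitz_on M f \<Longrightarrow> f z = 0 \<Longrightarrow>
        \<exists>\<sigma>. (\<forall>n. \<bar>\<sigma> n\<bar> \<le> 1) \<and> (\<forall>x\<in>M. (\<lambda>n. \<sigma> n * e n x) sums f x)"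
    then show ?thesis
      using free_space_isometric_l1[of z M e] assms(4) by presburger
  qed
qed

end
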